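(* Let $X$ be a complex Banach space with open unit ball $B_X$, and let $\varphi: B_X\to B_X$ be a holomorphic mapping. Let $C_\varphi: H_b(B_X)\to H_b(B_X)$, $C_\varphi(f)=f\circ\varphi$. The following assertions are equivalent: (1) $\varphi$ has $B_X$-stable orbits; (2) $C_\varphi: H_b(B_X)\to H_b(B_X)$ is power bounded; (3) the sequence $\big(\tfrac1n C_\varphi^n\big)_{n}$ is equicontinuous in $L(H_b(B_X))$; (4) $C_\varphi: H_b(B_X)\to H_b(B_X)$ is topologizable.
   Context: A function is holomorphic if it is (complex) Fréchet differentiable at every point. A set $A\subseteq B_X$ is $B_X$-bounded if it is bounded and has positive distance to the boundary of $B_X$ (that is, $A\subseteq rB_X$ for some $0<r<1$). $H_b(B_X)$ is the space of all holomorphic functions $f:B_X\to\mathbb{C}$ of bounded type (i.e. bounded on every $B_X$-bounded set), with the topology $\tau_b$ of uniform convergence on $B_X$-bounded sets; it is a Fréchet space. A map $\varphi:B_X\to B_X$ has $B_X$-stable orbits if for every $B_X$-bounded set $A$ there is a $B_X$-bounded set $L$ such that $\varphi^n(A)\subseteq L$ for every $n\in\mathbb{N}$, where $\varphi^n$ is the $n$-th iterate. For a locally convex Hausdorff space $E$, $\Gamma_E$ is the set of continuous seminorms on $E$, $L(E)$ is the space of continuous linear maps $E\to E$, and $T^n$ is the $n$-th iterate of $T$ ($T^0=\mathrm{id}$). $T\in L(E)$ is power bounded if $\{T^n: n\ge 0\}$ is equicontinuous. $T$ is topologizable if for each $q\in\Gamma_E$ there exist a sequence $(a_n)_{n\in\mathbb{N}}$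 of positive numbers and $p\in\Gamma_E$ such that $q(a_nT^nx)\le p(x)$ for all $x\in E$ and all $n\in\mathbb{N}$. *)

theory Defs
  imports "HOL-Analysis.Analysis"
begin

class complex_vector = real_vector +
  fixes scaleC :: "complex \<Rightarrow> 'a \<Rightarrow> 'a"  (infixr \<open>*\<^sub>C\<close> 75)
  assumes scaleC_add_right: "c *\<^sub>C (x + y) = c *\<^sub>C x + c *\<^sub>C y"
    and scaleC_add_left: "(c + d) *\<^sub>C x = c *\<^sub>C x + d *\<^sub>C x"
    and scaleC_scaleC: "c *\<^sub>C d *\<^sub>C x = (c * d) *\<^sub>C x"
    and scaleC_one: "1 *\<^sub>C x = x"
    and scaleR_scaleC: "r *\<^sub>R x = complex_of_real r *\<^sub>C x"

class complex_banach = complex_vector + banach +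
  assumes norm_scaleC: "norm (c *\<^sub>C x) = cmod c * norm x"

instantiation complex :: complex_banach
begin

definition scaleC_complex :: "complex \<Rightarrow> complex \<Rightarrow> complex"
  where "scaleC_complex c z = c * z"

instance
  by standard (simp_all add: scaleC_complex_def algebra_simps norm_mult scaleR_conv_of_real)

end

class locally_convex_t2 = complex_vector + topological_ab_group_add + t2_space +
  assumes tendsto_scaleC_nhds:
      "((\<lambda>(c, x). c *\<^sub>C x) \<longlongrightarrow> c0 *\<^sub>C x0) (nhds c0 \<times>\<^sub>F nhds x0)"
    and locally_convex:
      "open U \<Longrightarrow> 0 \<in> U \<Longrightarrow> \<exists>V\<subseteq>U. (\<forall>\<^sub>F x in nhds 0. x \<in> V) \<and>
        (\<forall>x\<in>V. \<forall>y\<in>V. \<forall>u v. 0 \<le> u \<and> 0 \<le> v \<and> u + v = 1 \<longrightarrow> u *\<^sub>R x + v *\<^sub>R y \<in> V)"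

definition complex_linear :: "('a::complex_vector \<Rightarrow> 'b::complex_vector) \<Rightarrow> bool"
  where "complex_linear T \<longleftrightarrow>
    (\<forall>x y. T (x + y) = T x + T y) \<and> (\<forall>c x. T (c *\<^sub>C x) = c *\<^sub>C T x)"

definition cont_seminorms :: "('e::locally_convex_t2 \<Rightarrow> real) set"
  where "cont_seminorms = {p. (\<forall>x y. p (x + y) \<le> p x + p y) \<and>
    (\<forall>c x. p (c *\<^sub>C x) = cmod c * p x) \<and> continuous_on UNIV p}"

definition cont_linear :: "('e::locally_convex_t2 \<Rightarrow> 'e) set"
  where "cont_linear = {T. complex_linear T \<and> continuous_on UNIV T}"

definition equicontinuous :: "('e::locally_convex_t2 \<Rightarrow> 'e) set \<Rightarrow> bool"
  where "equicontinuous H \<longleftrightarrow> H \<subseteq> cont_linear \<and>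
    (\<forall>U. open U \<and> 0 \<in> U \<longrightarrow> (\<exists>V. open V \<and> 0 \<in> V \<and> (\<forall>T\<in>H. T ` V \<subseteq> U)))"

definition power_bounded :: "('e::locally_convex_t2 \<Rightarrow> 'e) \<Rightarrow> bool"
  where "power_bounded T \<longleftrightarrow> T \<in> cont_linear \<and> equicontinuous (range (\<lambda>n. T ^^ n))"

definition topologizable :: "('e::locally_convex_t2 \<Rightarrow> 'e) \<Rightarrow> bool"
  where "topologizable T \<longleftrightarrow> T \<in> cont_linear \<and>
    (\<forall>q\<in>cont_seminorms. \<exists>a :: nat \<Rightarrow> real. \<exists>p\<in>cont_seminorms.
      (\<forall>n. 0 < a n) \<and> (\<forall>x n. q (a n *\<^sub>R (T ^^ n) x) \<le> p x))"

(* For open S, "at x" and "at x within S" give the same derivatives; holomorphic_on is the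
   library's notion for functions of one complex variable. *)
definition frechet_holomorphic_on ::
    "('a::complex_banach \<Rightarrow> 'b::complex_banach) \<Rightarrow> 'a set \<Rightarrow> bool"
  where "frechet_holomorphic_on f S \<longleftrightarrow>
    (\<forall>x\<in>S. \<exists>D. (f has_derivative D) (at x) \<and> complex_linear D)"

definition ball_bounded :: "'a::complex_banach set \<Rightarrow> bool"
  where "ball_bounded A \<longleftrightarrow> (\<exists>r. 0 < r \<and> r < 1 \<and> A \<subseteq> ball 0 r)"

definition stable_orbits :: "('a::complex_banach \<Rightarrow> 'a) \<Rightarrow> bool"
  where "stable_orbits \<phi> \<longleftrightarrow>
    (\<forall>A. ball_bounded A \<longrightarrow> (\<exists>L. ball_bounded L \<and> (\<forall>n. (\<phi> ^^ n) ` A \<subseteq> L)))"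

(* A function on the unit ball is represented by its extension by zero to the whole space, so that
   equality in the type below is equality on the ball. *)
definition Hb_set :: "('a::complex_banach \<Rightarrow> complex) set"
  where "Hb_set = {f. frechet_holomorphic_on f (ball 0 1) \<and>
    (\<forall>A. ball_bounded A \<longrightarrow> bounded (f ` A)) \<and> (\<forall>x. x \<notin> ball 0 1 \<longrightarrow> f x = 0)}"

lemma Hb_set_lincomb:
  assumes "f \<in> Hb_set" "g \<in> Hb_set"
  shows "(\<lambda>x. c * f x + d * g x) \<in> Hb_set"
proof -
  have "\<exists>D. ((\<lambda>x. c * f x + d * g x) has_derivative D) (at x) \<and> complex_linear D"
    if x: "x \<in> ball 0 1" for x
  proof -
    obtain D E where D: "(f has_derivative D) (at x)" "complex_linear D"
      and E: "(g has_derivative E) (at x)" "complex_linear E"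
      using assms x unfolding Hb_set_def frechet_holomorphic_on_def by blast
    have "((\<lambda>x. c * f x + d * g x) has_derivative (\<lambda>h. c * D h + d * E h)) (at x)"
      by (intro derivative_intros D E)
    moreover have "complex_linear (\<lambda>h. c * D h + d * E h)"
      using D(2) E(2) by (simp add: complex_linear_def scaleC_complex_def algebra_simps)
    ultimately show ?thesis by blast
  qed
  moreover have "bounded ((\<lambda>x. c * f x + d * g x) ` A)" if A: "ball_bounded A" for A
  proof -
    obtain M N where "\<And>x. x \<in> A \<Longrightarrow> cmod (f x) \<le> M" "\<And>x. x \<in> A \<Longrightarrow> cmod (g x) \<le> N"
      using assms A by (auto simp: Hb_set_def bounded_iff) meson
    then have "cmod (c * f x + d * g x) \<le> cmod c * M + cmod d * N" if "x \<in> A" for x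
      using that
      by (intro order.trans[OF norm_triangle_ineq] add_mono) (auto simp: norm_mult mult_left_mono)
    then show ?thesis by (auto simp: bounded_iff)
  qed
  ultimately show ?thesis
    using assms by (auto simp: Hb_set_def frechet_holomorphic_on_def)
qed

lemma zero_in_Hb_set: "(\<lambda>x. 0) \<in> Hb_set"
  by (auto simp: Hb_set_def frechet_holomorphic_on_def complex_linear_def bounded_iff
      scaleC_complex_def intro!: exI[of _ "\<lambda>_. 0"])

typedef (overloaded) 'a Hb = "Hb_set :: ('a::complex_banach \<Rightarrow> complex) set"
  morphisms Hb_fun Abs_Hb
  using zero_in_Hb_set by blast

setup_lifting type_definition_Hb

lemma Hb_eqI:
  assumes "\<And>x. x \<in> ball 0 1 \<Longrightarrow> Hb_fun f x = Hb_fun g x"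
  shows "f = g"
proof -
  have "Hb_fun f x = Hb_fun g x" for x
    using assms Hb_fun[of f] Hb_fun[of g] by (cases "x \<in> ball 0 1") (auto simp: Hb_set_def)
  then show ?thesis by (simp add: Hb_fun_inject[symmetric] fun_eq_iff)
qed

instantiation Hb :: (complex_banach) complex_vector
begin

lift_definition zero_Hb :: "'a Hb" is "\<lambda>x. 0"
  by (rule zero_in_Hb_set)

lift_definition plus_Hb :: "'a Hb \<Rightarrow> 'a Hb \<Rightarrow> 'a Hb" is "\<lambda>f g x. f x + g x"
  subgoal for f g using Hb_set_lincomb[of f g 1 1] by simp done

lift_definition uminus_Hb :: "'a Hb \<Rightarrow> 'a Hb" is "\<lambda>f x. - f x"
  subgoal for f using Hb_set_lincomb[of f f "-1" 0] by simp done

lift_definition minus_Hb :: "'a Hb \<Rightarrow> 'a Hb \<Rightarrow> 'a Hb" is "\<lambda>f g x. f x - g x"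
  subgoal for f g using Hb_set_lincomb[of f g 1 "-1"] by simp done

lift_definition scaleC_Hb :: "complex \<Rightarrow> 'a Hb \<Rightarrow> 'a Hb" is "\<lambda>c f x. c * f x"
  subgoal for c f using Hb_set_lincomb[of f f c 0] by simp done

definition scaleR_Hb :: "real \<Rightarrow> 'a Hb \<Rightarrow> 'a Hb"
  where "scaleR_Hb r f = complex_of_real r *\<^sub>C f"

instance
  by standard
    (rule Hb_eqI, simp add: scaleR_Hb_def zero_Hb.rep_eq plus_Hb.rep_eq uminus_Hb.rep_eq
      minus_Hb.rep_eq scaleC_Hb.rep_eq algebra_simps)+

end

lemmas Hb_fun_simps [simp] = zero_Hb.rep_eq plus_Hb.rep_eq uminus_Hb.rep_eq minus_Hb.rep_eq
  scaleC_Hb.rep_eq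

lemma Hb_fun_scaleR [simp]: "Hb_fun (r *\<^sub>R f) x = complex_of_real r * Hb_fun f x"
  by (simp add: scaleR_Hb_def)

lemma ball_bounded_Un: "ball_bounded A \<Longrightarrow> ball_bounded B \<Longrightarrow> ball_bounded (A \<union> B)"
  unfolding ball_bounded_def
proof (elim exE conjE)
  fix r s :: real
  assume "0 < r" "r < 1" "A \<subseteq> ball 0 r" "0 < s" "s < 1" "B \<subseteq> ball 0 s"
  then show "\<exists>r>0. r < 1 \<and> A \<union> B \<subseteq> ball 0 r"
    by (intro exI[of _ "max r s"]) (auto simp: subset_eq less_max_iff_disj)
qed

lemma Hb_fun_bounded:
  assumes "ball_bounded A"
  obtains M where "0 \<le> M" "\<And>x. x \<in> A \<Longrightarrow> cmod (Hb_fun f x) \<le> M"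
proof -
  have "bounded (Hb_fun f ` A)"
    using assms Hb_fun[of f] by (auto simp: Hb_set_def)
  then obtain M where "0 < M" "\<And>x. x \<in> A \<Longrightarrow> cmod (Hb_fun f x) \<le> M"
    by (auto simp: bounded_pos)
  then show ?thesis using that[of M] by simp
qed

instantiation Hb :: (complex_banach) topological_space
begin

(* Uniform convergence on the ball-bounded sets; a single set suffices in the basic neighbourhoods
   because finite unions of ball-bounded sets are ball-bounded. *)
definition open_Hb :: "'a Hb set \<Rightarrow> bool"
  where "open_Hb U \<longleftrightarrow> (\<forall>f\<in>U. \<exists>A e. ball_bounded A \<and> 0 < e \<and>
    (\<forall>g. (\<forall>x\<in>A. cmod (Hb_fun g x - Hb_fun f x) < e) \<longrightarrow> g \<in> U))"

instance
proof
  show "open (UNIV :: 'a Hb set)"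
    by (auto simp: open_Hb_def ball_bounded_def intro!: exI[of _ "{}"] exI[of _ 1] exI[of _ "1/2::real"])
next
  fix S T :: "'a Hb set" assume S: "open S" and T: "open T"
  show "open (S \<inter> T)"
    unfolding open_Hb_def
  proof
    fix f assume f: "f \<in> S \<inter> T"
    obtain A e B d where *: "ball_bounded A" "0 < e" "ball_bounded B" "0 < d"
      "\<And>g. \<forall>x\<in>A. cmod (Hb_fun g x - Hb_fun f x) < e \<Longrightarrow> g \<in> S"
      "\<And>g. \<forall>x\<in>B. cmod (Hb_fun g x - Hb_fun f x) < d \<Longrightarrow> g \<in> T"
      using S T f unfolding open_Hb_def by (metis IntE)
    show "\<exists>A e. ball_bounded A \<and> 0 < e \<and>
        (\<forall>g. (\<forall>x\<in>A. cmod (Hb_fun g x - Hb_fun f x) < e) \<longrightarrow> g \<in> S \<inter> T)"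
      using * by (intro exI[of _ "A \<union> B"] exI[of _ "min e d"]) (auto simp: ball_bounded_Un)
  qed
next
  fix K :: "'a Hb set set" assume "\<forall>S\<in>K. open S"
  then show "open (\<Union>K)"
    unfolding open_Hb_def by (meson UnionE UnionI)
qed

end

lemma eventually_nhds_Hb:
  fixes f :: "'a::complex_banach Hb"
  shows "eventually P (nhds f) \<longleftrightarrow> (\<exists>A e. ball_bounded A \<and> 0 < e \<and>
    (\<forall>g. (\<forall>x\<in>A. cmod (Hb_fun g x - Hb_fun f x) < e) \<longrightarrow> P g))"
proof
  assume "eventually P (nhds f)"
  then obtain U where U: "open U" "f \<in> U" "\<And>g. g \<in> U \<Longrightarrow> P g"
    by (auto simp: eventually_nhds)
  then obtain A e where "ball_bounded A" "0 < e"
      "\<forall>g. (\<forall>x\<in>A. cmod (Hb_fun g x - Hb_fun f x) < e) \<longrightarrow> g \<in> U"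
    unfolding open_Hb_def by blast
  then show "\<exists>A e. ball_bounded A \<and> 0 < e \<and>
      (\<forall>g. (\<forall>x\<in>A. cmod (Hb_fun g x - Hb_fun f x) < e) \<longrightarrow> P g)"
    using U(3) by blast
next
  assume "\<exists>A e. ball_bounded A \<and> 0 < e \<and>
      (\<forall>g. (\<forall>x\<in>A. cmod (Hb_fun g x - Hb_fun f x) < e) \<longrightarrow> P g)"
  then obtain A e where A: "ball_bounded A" "0 < e"
      "\<And>g. \<forall>x\<in>A. cmod (Hb_fun g x - Hb_fun f x) < e \<Longrightarrow> P g"
    by blast
  define U where "U = {g. \<exists>d<e. \<forall>x\<in>A. cmod (Hb_fun g x - Hb_fun f x) \<le> d}"
  have "open U"
    unfolding open_Hb_def
  proof
    fix g assume "g \<in> U"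
    then obtain d where d: "d < e" "\<And>x. x \<in> A \<Longrightarrow> cmod (Hb_fun g x - Hb_fun f x) \<le> d"
      by (auto simp: U_def)
    have "h \<in> U" if h: "\<forall>x\<in>A. cmod (Hb_fun h x - Hb_fun g x) < (e - d) / 2" for h
    proof -
      have "cmod (Hb_fun h x - Hb_fun f x) \<le> (e + d) / 2" if "x \<in> A" for x
      proof -
        have "cmod (Hb_fun h x - Hb_fun f x)
            \<le> cmod (Hb_fun h x - Hb_fun g x) + cmod (Hb_fun g x - Hb_fun f x)"
          using norm_triangle_ineq[of "Hb_fun h x - Hb_fun g x" "Hb_fun g x - Hb_fun f x"] by simp
        also have "\<dots> \<le> (e - d) / 2 + d"
          using h d(2) that by (intro add_mono) (auto intro: less_imp_le)
        finally show ?thesis by (simp add: field_simps)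
      qed
      then show ?thesis
        unfolding U_def using d(1) by (intro CollectI exI[of _ "(e + d) / 2"]) auto
    qed
    then show "\<exists>A e. ball_bounded A \<and> 0 < e \<and>
        (\<forall>h. (\<forall>x\<in>A. cmod (Hb_fun h x - Hb_fun g x) < e) \<longrightarrow> h \<in> U)"
      using A(1) d(1) by (intro exI[of _ A] exI[of _ "(e - d) / 2"]) auto
  qed
  moreover have "f \<in> U"
    using A(2) by (auto simp: U_def)
  moreover have "P g" if "g \<in> U" for g
    using that A(3)[of g] by (force simp: U_def)
  ultimately show "eventually P (nhds f)"
    by (auto simp: eventually_nhds)
qed

lemma eventually_nhds_HbI:
  fixes f :: "'a::complex_banach Hb"
  assumes "ball_bounded A" "0 < e"
  shows "\<forall>\<^sub>F g in nhds f. \<forall>x\<in>A. cmod (Hb_fun g x - Hb_fun f x) < e"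
  using assms by (auto simp: eventually_nhds_Hb)

lemma tendsto_HbI:
  fixes l :: "'a::complex_banach Hb"
  assumes "\<And>A e. ball_bounded A \<Longrightarrow> 0 < e \<Longrightarrow> \<forall>\<^sub>F y in F. \<forall>x\<in>A. cmod (Hb_fun (u y) x - Hb_fun l x) < e"
  shows "(u \<longlongrightarrow> l) F"
  unfolding filterlim_iff
proof (intro allI impI)
  fix P assume "eventually P (nhds l)"
  then obtain A e where "ball_bounded A" "0 < e"
      and P: "\<And>g. \<forall>x\<in>A. cmod (Hb_fun g x - Hb_fun l x) < e \<Longrightarrow> P g"
    by (auto simp: eventually_nhds_Hb)
  then show "\<forall>\<^sub>F y in F. P (u y)"
    using eventually_mono[OF assms[of A e]] by simp
qed

instance Hb :: (complex_banach) locally_convex_t2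
proof
  fix f g :: "'a Hb"
  show "((\<lambda>p. fst p + snd p) \<longlongrightarrow> f + g) (nhds f \<times>\<^sub>F nhds g)"
  proof (rule tendsto_HbI)
    fix A :: "'a set" and e :: real assume A: "ball_bounded A" "0 < e"
    have "\<forall>\<^sub>F p in nhds f \<times>\<^sub>F nhds g. (\<forall>x\<in>A. cmod (Hb_fun (fst p) x - Hb_fun f x) < e/2)
        \<and> (\<forall>x\<in>A. cmod (Hb_fun (snd p) x - Hb_fun g x) < e/2)"
      using A
      by (intro eventually_conj
          eventually_compose_filterlim[OF eventually_nhds_HbI filterlim_fst]
          eventually_compose_filterlim[OF eventually_nhds_HbI filterlim_snd]) auto
    then show "\<forall>\<^sub>F p in nhds f \<times>\<^sub>F nhds g.
        \<forall>x\<in>A. cmod (Hb_fun (fst p + snd p) x - Hb_fun (f + g) x) < e"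
    proof (rule eventually_mono, intro ballI)
      fix p x
      assume *: "(\<forall>x\<in>A. cmod (Hb_fun (fst p) x - Hb_fun f x) < e/2)
        \<and> (\<forall>x\<in>A. cmod (Hb_fun (snd p) x - Hb_fun g x) < e/2)" and x: "x \<in> A"
      have "cmod (Hb_fun (fst p + snd p) x - Hb_fun (f + g) x) \<le>
          cmod (Hb_fun (fst p) x - Hb_fun f x) + cmod (Hb_fun (snd p) x - Hb_fun g x)"
        by (simp add: norm_diff_triangle_ineq)
      then show "cmod (Hb_fun (fst p + snd p) x - Hb_fun (f + g) x) < e"
        using * x by fastforce
    qed
  qed
next
  fix f :: "'a Hb"
  show "(uminus \<longlongrightarrow> - f) (nhds f)"
  proof (rule tendsto_HbI)
    fix A :: "'a set" and e :: real assume A: "ball_bounded A" "0 < e"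
    show "\<forall>\<^sub>F g in nhds f. \<forall>x\<in>A. cmod (Hb_fun (- g) x - Hb_fun (- f) x) < e"
      using eventually_nhds_HbI[OF A, of f] by (simp add: norm_minus_commute)
  qed
next
  fix f g :: "'a Hb" assume "f \<noteq> g"
  then obtain x where x: "x \<in> ball 0 1" "Hb_fun f x \<noteq> Hb_fun g x"
    using Hb_eqI by blast
  define e where "e = cmod (Hb_fun f x - Hb_fun g x) / 2"
  have e: "0 < e" using x by (simp add: e_def)
  have A: "ball_bounded {x}"
    using x dense[of "norm x" 1] unfolding ball_bounded_def
    by (auto intro: order.strict_trans1[OF norm_ge_zero])
  obtain U V where U: "open U" "f \<in> U" "\<And>h. h \<in> U \<Longrightarrow> cmod (Hb_fun h x - Hb_fun f x) < e"
    and V: "open V" "g \<in> V" "\<And>h. h \<in> V \<Longrightarrow> cmod (Hb_fun h x - Hb_fun g x) < e"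
    using eventually_nhds_HbI[OF A e, of f] eventually_nhds_HbI[OF A e, of g]
    by (auto simp: eventually_nhds)
  have "False" if "h \<in> U" "h \<in> V" for h
  proof -
    have "cmod (Hb_fun f x - Hb_fun g x)
        \<le> cmod (Hb_fun h x - Hb_fun f x) + cmod (Hb_fun h x - Hb_fun g x)"
      by (metis dist_commute dist_norm dist_triangle)
    then show False using U(3)[OF that(1)] V(3)[OF that(2)] by (simp add: e_def)
  qed
  then show "\<exists>U V. open U \<and> open V \<and> f \<in> U \<and> g \<in> V \<and> U \<inter> V = {}"
    using U(1,2) V(1,2) by blast
next
  fix c0 :: complex and f :: "'a Hb"
  show "((\<lambda>(c, x). c *\<^sub>C x) \<longlongrightarrow> c0 *\<^sub>C f) (nhds c0 \<times>\<^sub>F nhds f)"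
  proof (rule tendsto_HbI)
    fix A :: "'a set" and e :: real assume A: "ball_bounded A" "0 < e"
    obtain M where M: "0 \<le> M" "\<And>x. x \<in> A \<Longrightarrow> cmod (Hb_fun f x) \<le> M"
      using Hb_fun_bounded[OF A(1)] by metis
    have half: "t * (e / (2 * t)) = e / 2" if "0 < t" for t :: real
      using that by simp
    define d where "d = e / (2 * (cmod c0 + 1))"
    define k where "k = min 1 (e / (2 * (M + 1)))"
    have d: "0 < d" "(cmod c0 + 1) * d = e / 2"
    proof -
      have "0 < cmod c0 + 1" using norm_ge_zero[of c0] by linarith
      then show "0 < d" "(cmod c0 + 1) * d = e / 2"
        using A(2) half[of "cmod c0 + 1"]
        by (simp_all only: d_def divide_pos_pos mult_pos_pos zero_less_numeral)
    qed
    have k: "0 < k" "k \<le> 1" "k * M \<le> e / 2"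
    proof -
      show "0 < k" "k \<le> 1" using A(2) M(1) by (auto simp: k_def)
      have "k * M \<le> e / (2 * (M + 1)) * (M + 1)"
        using A(2) M(1) by (intro mult_mono) (auto simp: k_def)
      then show "k * M \<le> e / 2"
        using half[of "M + 1"] M(1) by (simp add: mult.commute)
    qed
    have "\<forall>\<^sub>F p in nhds c0 \<times>\<^sub>F nhds f. cmod (fst p - c0) < k
        \<and> (\<forall>x\<in>A. cmod (Hb_fun (snd p) x - Hb_fun f x) < d)"
    proof (rule eventually_conj)
      have "\<forall>\<^sub>F c in nhds c0. cmod (c - c0) < k"
        using k(1) by (auto simp: eventually_nhds_metric dist_norm)
      then show "\<forall>\<^sub>F p in nhds c0 \<times>\<^sub>F nhds f. cmod (fst p - c0) < k"
        by (rule eventually_compose_filterlim[OF _ filterlim_fst])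
      show "\<forall>\<^sub>F p in nhds c0 \<times>\<^sub>F nhds f. \<forall>x\<in>A. cmod (Hb_fun (snd p) x - Hb_fun f x) < d"
        by (rule eventually_compose_filterlim[OF eventually_nhds_HbI[OF A(1) d(1)] filterlim_snd])
    qed
    then show "\<forall>\<^sub>F p in nhds c0 \<times>\<^sub>F nhds f.
        \<forall>x\<in>A. cmod (Hb_fun (case p of (c, x) \<Rightarrow> c *\<^sub>C x) x - Hb_fun (c0 *\<^sub>C f) x) < e"
    proof (rule eventually_mono, intro ballI)
      fix p :: "complex \<times> 'a Hb" and x
      assume *: "cmod (fst p - c0) < k \<and> (\<forall>x\<in>A. cmod (Hb_fun (snd p) x - Hb_fun f x) < d)"
        and x: "x \<in> A"
      obtain c g where p: "p = (c, g)" by (cases p)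
      have c: "cmod c \<le> cmod c0 + 1" "cmod (c - c0) < k"
        using * p k(2) norm_triangle_ineq2[of c c0] by auto
      have "cmod c * cmod (Hb_fun g x - Hb_fun f x) \<le> (cmod c0 + 1) * cmod (Hb_fun g x - Hb_fun f x)"
        using c(1) by (rule mult_right_mono) simp
      also have "\<dots> < (cmod c0 + 1) * d"
        using * p x by (intro mult_strict_left_mono) (auto simp: add_nonneg_pos)
      finally have 1: "cmod c * cmod (Hb_fun g x - Hb_fun f x) < e / 2"
        using d(2) by simp
      have "cmod (c - c0) * cmod (Hb_fun f x) \<le> k * M"
        using c(2) M k(1) x by (intro mult_mono) auto
      then have 2: "cmod (c - c0) * cmod (Hb_fun f x) \<le> e / 2"
        using k(3) by simp
      have "c * Hb_fun g x - c0 * Hb_fun f x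
          = c * (Hb_fun g x - Hb_fun f x) + (c - c0) * Hb_fun f x"
        by (simp add: algebra_simps)
      then have "cmod (c * Hb_fun g x - c0 * Hb_fun f x)
          \<le> cmod c * cmod (Hb_fun g x - Hb_fun f x) + cmod (c - c0) * cmod (Hb_fun f x)"
        by (metis norm_mult norm_triangle_ineq)
      with 1 2 p show "cmod (Hb_fun (case p of (c, x) \<Rightarrow> c *\<^sub>C x) x - Hb_fun (c0 *\<^sub>C f) x) < e"
        by simp
    qed
  qed
next
  fix U :: "'a Hb set" assume "open U" "0 \<in> U"
  then obtain A e where A: "ball_bounded A" "0 < e"
      "\<And>g. \<forall>x\<in>A. cmod (Hb_fun g x - Hb_fun 0 x) < e \<Longrightarrow> g \<in> U"
    unfolding open_Hb_def by blast
  define V where "V = {g :: 'a Hb. \<forall>x\<in>A. cmod (Hb_fun g x) < e}"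
  have "u *\<^sub>R f + v *\<^sub>R g \<in> V"
    if fg: "f \<in> V" "g \<in> V" and uv: "0 \<le> u" "0 \<le> v" "u + v = 1" for f g u v
  proof -
    have "cmod (Hb_fun (u *\<^sub>R f + v *\<^sub>R g) x) < e" if x: "x \<in> A" for x
    proof -
      have "u *\<^sub>R Hb_fun f x + v *\<^sub>R Hb_fun g x \<in> ball 0 e"
        using fg uv x by (intro convexD[OF convex_ball]) (auto simp: V_def)
      then show ?thesis by (simp add: scaleR_conv_of_real)
    qed
    then show ?thesis by (simp add: V_def)
  qed
  moreover have "\<forall>\<^sub>F f in nhds 0. f \<in> V"
    using eventually_nhds_HbI[OF A(1,2), of 0] by (simp add: V_def)
  moreover have "V \<subseteq> U"
    using A(3) by (auto simp: V_def)
  ultimately show "\<exists>V\<subseteq>U. (\<forall>\<^sub>F x in nhds 0. x \<in> V) \<and>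
      (\<forall>x\<in>V. \<forall>y\<in>V. \<forall>u v. 0 \<le> u \<and> 0 \<le> v \<and> u + v = 1 \<longrightarrow> u *\<^sub>R x + v *\<^sub>R y \<in> V)"
    by blast
qed

(* For a holomorphic self-map \<phi> of the ball the function below always lies in Hb_set: by the
   Schwarz-Pick lemma \<phi> maps ball-bounded sets to ball-bounded sets. *)
definition comp_op :: "('a::complex_banach \<Rightarrow> 'a) \<Rightarrow> 'a Hb \<Rightarrow> 'a Hb"
  where "comp_op \<phi> f = Abs_Hb (\<lambda>x. if x \<in> ball 0 1 then Hb_fun f (\<phi> x) else 0)"

end

theory Submission
  imports Defs "HOL-Complex_Analysis.Riemann_Mapping"
begin

text \<open>
  Stability of the orbits makes all iterates of \<open>\<phi>\<close> map a given ball of radius less than one into one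
  such ball, and then the powers \<open>f \<mapsto> f \<circ> \<phi>\<^sup>n\<close> are bounded by a single seminorm, with or without
  the factor \<open>1 / n\<close> (\<open>stable_orbits_imp_equicontinuous\<close>). Equicontinuity of the powers, even after
  division by \<open>n\<close>, is a case of topologizability (\<open>equicontinuous_imp_topologizable\<close>).

  The circle closes because the space is an algebra. Topologizability is an inequality
  \<open>a\<^sub>n sup \<bar>f \<circ> \<phi>\<^sup>n\<bar> \<le> C sup \<bar>f\<bar>\<close> between suprema over two balls, for every \<open>f\<close>. Replacing \<open>f\<close> by \<open>f\<^sup>k\<close>,
  taking \<open>k\<close>-th roots and letting \<open>k\<close> tend to infinity removes the constants \<open>a\<^sub>n\<close> and \<open>C\<close>. With \<open>f\<close> a
  functional that norms a point of the orbit, what remains says that this point lies in the second ball,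
  whose radius does not depend on \<open>n\<close> (\<open>topologizable_imp_stable_orbits\<close>).

  Two tools carry this. Norming functionals exist by the Hahn-Banach theorem
  (\<open>exists_norming_functional\<close>), obtained from minimal sublinear functionals. And the composition operator
  acts on functions of bounded type because a holomorphic self-map of the ball maps smaller balls into
  smaller balls (\<open>self_map_image_ball_bounded\<close>), a consequence of the Schwarz lemma on complex lines.
\<close>

section \<open>Norming functionals\<close>

text \<open>Only an inequality for positive scalars is demanded, because infima of sublinear functionals
  satisfy it for an obvious reason. Equality follows by scaling back with the inverse scalar.\<close>

definition sublinear :: "('a::real_vector \<Rightarrow> real) \<Rightarrow> bool"
  where "sublinear p \<longleftrightarrow>
    (\<forall>x y. p (x + y) \<le> p x + p y) \<and> (\<forall>t x. 0 < t \<longrightarrow> p (t *\<^sub>R x) \<le> t * p x)"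

lemma sublinear_add: "sublinear p \<Longrightarrow> p (x + y) \<le> p x + p y"
  by (simp add: sublinear_def)

lemma sublinear_scaleR_le: "sublinear p \<Longrightarrow> 0 < t \<Longrightarrow> p (t *\<^sub>R x) \<le> t * p x"
  by (simp add: sublinear_def)

lemma sublinear_zero:
  assumes "sublinear p"
  shows "p 0 = 0"
proof -
  have "p (2 *\<^sub>R 0) \<le> 2 * p 0" "p ((1/2) *\<^sub>R 0) \<le> 1/2 * p 0"
    by (intro sublinear_scaleR_le[OF assms]; simp)+
  then show ?thesis by simp
qed

lemma sublinear_scaleR:
  assumes "sublinear p" "0 \<le> t"
  shows "p (t *\<^sub>R x) = t * p x"
proof (cases "t = 0")
  case False
  then have t: "0 < t" using assms(2) by simp
  have "p ((1/t) *\<^sub>R (t *\<^sub>R x)) \<le> 1/t * p (t *\<^sub>R x)"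
    using t by (intro sublinear_scaleR_le[OF assms(1)]) simp
  moreover have "p (t *\<^sub>R x) \<le> t * p x"
    using assms(1) t by (simp add: sublinear_def)
  ultimately show ?thesis
    using t by (simp add: field_simps)
qed (simp add: sublinear_zero[OF assms(1)])

lemma sublinear_minus_le:
  assumes "sublinear p"
  shows "- p (- x) \<le> p x"
  using sublinear_add[OF assms, of x "- x"] sublinear_zero[OF assms] by simp

lemma sublinear_norm: "sublinear norm"
  by (simp add: sublinear_def norm_triangle_ineq)

text \<open>The largest sublinear functional below \<open>p\<close> that agrees with \<open>p\<close> at \<open>y\<close> and is linear on the line
  through \<open>y\<close>.\<close>

definition linearize_along :: "'a::real_vector \<Rightarrow> ('a \<Rightarrow> real) \<Rightarrow> 'a \<Rightarrow> real"
  where "linearize_along y p x = (INF t\<in>{0..}. p (x + t *\<^sub>R y) - t * p y)"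

text \<open>The infimum is over a set bounded below: subadditivity gives
  \<open>t * p y = p (t *\<^sub>R y) \<le> p (x + t *\<^sub>R y) + p (- x)\<close>, so that \<open>- p (- x)\<close> is a lower bound.\<close>

lemma linearize_along_le:
  assumes p: "sublinear p" and t: "0 \<le> t"
  shows "linearize_along y p x \<le> p (x + t *\<^sub>R y) - t * p y"
proof -
  have "- p (- x) \<le> p (x + s *\<^sub>R y) - s * p y" if "0 \<le> s" for s
    using sublinear_add[OF p, of "x + s *\<^sub>R y" "- x"] sublinear_scaleR[OF p that, of y] by simp
  then have "bdd_below ((\<lambda>t. p (x + t *\<^sub>R y) - t * p y) ` {0..})"
    by (intro bdd_belowI2) auto
  then show ?thesis
    unfolding linearize_along_def using t by (intro cINF_lower) auto
qed

lemma le_linearize_along: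
  assumes "\<And>t. 0 \<le> t \<Longrightarrow> c \<le> p (x + t *\<^sub>R y) - t * p y"
  shows "c \<le> linearize_along y p x"
  unfolding linearize_along_def using assms by (intro cINF_greatest) auto

lemma sublinear_linearize_along:
  assumes p: "sublinear p"
  shows "sublinear (linearize_along y p)"
  unfolding sublinear_def
proof (intro conjI allI impI)
  fix x z
  have *: "linearize_along y p (x + z) \<le> (p (x + t *\<^sub>R y) - t * p y) + (p (z + s *\<^sub>R y) - s * p y)"
    if "0 \<le> t" "0 \<le> s" for s t
  proof -
    have "linearize_along y p (x + z) \<le> p (x + z + (t + s) *\<^sub>R y) - (t + s) * p y"
      using that by (intro linearize_along_le p) auto
    also have "x + z + (t + s) *\<^sub>R y = (x + t *\<^sub>R y) + (z + s *\<^sub>R y)"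
      by (simp add: algebra_simps)
    finally show ?thesis
      using sublinear_add[OF p, of "x + t *\<^sub>R y" "z + s *\<^sub>R y"] by (simp add: algebra_simps)
  qed
  have "linearize_along y p (x + z) - (p (x + t *\<^sub>R y) - t * p y) \<le> linearize_along y p z"
    if "0 \<le> t" for t
    by (rule le_linearize_along) (use *[OF that] in \<open>simp add: algebra_simps\<close>)
  then have "linearize_along y p (x + z) - linearize_along y p z \<le> linearize_along y p x"
    by (intro le_linearize_along) (simp add: algebra_simps)
  then show "linearize_along y p (x + z) \<le> linearize_along y p x + linearize_along y p z"
    by simp
next
  fix s :: real and x assume s: "0 < s"
  have "linearize_along y p (s *\<^sub>R x) / s \<le> p (x + t *\<^sub>R y) - t * p y" if "0 \<le> t" for t
  proof -
    have "linearize_along y p (s *\<^sub>R x) \<le> p (s *\<^sub>R x + (s * t) *\<^sub>R y) - (s * t) * p y"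
      using that s by (intro linearize_along_le p) auto
    also have "s *\<^sub>R x + (s * t) *\<^sub>R y = s *\<^sub>R (x + t *\<^sub>R y)"
      by (simp add: algebra_simps)
    finally show ?thesis
      using s sublinear_scaleR[OF p, of s "x + t *\<^sub>R y"] by (simp add: field_simps)
  qed
  then have "linearize_along y p (s *\<^sub>R x) / s \<le> linearize_along y p x"
    by (rule le_linearize_along)
  then show "linearize_along y p (s *\<^sub>R x) \<le> s * linearize_along y p x"
    using s by (simp add: field_simps)
qed

lemma linearize_along_decreases:
  assumes "sublinear p"
  shows "linearize_along y p \<le> p"
  using linearize_along_le[OF assms, of 0] by (intro le_funI) simp

text \<open>A minimal functional is not changed by linearizing it along \<open>y\<close>. The competitor with parameter
  \<open>1\<close> in the infimum then gives \<open>p x \<le> p (x + y) - p y\<close>, which is superadditivity.\<close>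

lemma minimal_sublinear_imp_linear:
  assumes p: "sublinear p" and minimal: "\<And>q. sublinear q \<Longrightarrow> q \<le> p \<Longrightarrow> q = p"
  shows "linear p"
proof -
  have add: "p (x + y) = p x + p y" for x y
  proof -
    have "p = linearize_along y p"
      using minimal[OF sublinear_linearize_along[OF p] linearize_along_decreases[OF p], of y] by simp
    then have "p x \<le> p (x + y) - p y"
      using linearize_along_le[OF p, of 1 y x] by simp
    then show ?thesis using sublinear_add[OF p, of x y] by simp
  qed
  have neg: "p (- x) = - p x" for x
    using add[of x "- x"] sublinear_zero[OF p] by simp
  have "p (c *\<^sub>R x) = c * p x" for c x
    using sublinear_scaleR[OF p, of c x] sublinear_scaleR[OF p, of "- c" x] neg[of "c *\<^sub>R x"]
    by (cases "0 \<le> c") auto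
  then show ?thesis
    by (intro linearI) (auto simp: add)
qed

text \<open>The Hahn-Banach theorem in the form of a Zorn argument on sublinear functionals, ordered pointwise:
  all functionals below \<open>p\<close> have the lower bound \<open>- p (- x)\<close> at \<open>x\<close>, hence the
  pointwise infimum of a chain is finite and again sublinear, and a minimal element is linear.\<close>

lemma exists_linear_below_sublinear:
  fixes p :: "'a::real_vector \<Rightarrow> real"
  assumes p: "sublinear p"
  obtains f where "linear f" "f \<le> p"
proof -
  define A where "A = {q. sublinear q \<and> q \<le> p}"
  have po: "partial_order_on A (relation_of (\<ge>) A)"
    by (rule partial_order_on_relation_ofI) auto
  have chain: "\<exists>u\<in>A. \<forall>q\<in>C. u \<le> q" if "C \<in> Chains (relation_of (\<ge>) A)" for C
  proof (cases "C = {}")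
    case True
    then show ?thesis using p by (auto simp: A_def)
  next
    case False
    have CA: "q \<in> A" if "q \<in> C" for q
      using \<open>C \<in> _\<close> that by (auto simp: Chains_def relation_of_def)
    have total: "q \<le> r \<or> r \<le> q" if "q \<in> C" "r \<in> C" for q r
      using \<open>C \<in> _\<close> that by (auto simp: Chains_def relation_of_def)
    define u where "u x = (INF q\<in>C. q x)" for x
    have below: "u x \<le> q x" if "q \<in> C" for q x
    proof -
      have "- p (- x) \<le> r x" if "r \<in> C" for r
        using CA[OF that] sublinear_minus_le[of r x] le_funD[of r p "- x"] by (auto simp: A_def)
      then have "bdd_below ((\<lambda>q. q x) ` C)" by (intro bdd_belowI2) auto
      then show ?thesis unfolding u_def using that by (rule cINF_lower)
    qed
    have greatest: "c \<le> u x" if "\<And>q. q \<in> C \<Longrightarrow> c \<le> q x" for c x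
      unfolding u_def using False that by (rule cINF_greatest)
    have "sublinear u"
      unfolding sublinear_def
    proof (intro conjI allI impI)
      fix x y
      have *: "u (x + y) \<le> q x + r y" if qr: "q \<in> C" "r \<in> C" for q r
      proof -
        \<comment> \<open>Being a chain is used here: one functional below both \<open>q\<close> and \<open>r\<close> bounds both summands.\<close>
        obtain s where s: "s \<in> C" "s \<le> q" "s \<le> r"
          using total[OF qr] qr by auto
        have "u (x + y) \<le> s x + s y"
          using below[OF s(1), of "x + y"] CA[OF s(1)] sublinear_add[of s x y] by (simp add: A_def)
        then show ?thesis
          using le_funD[OF s(2), of x] le_funD[OF s(3), of y] by simp
      qed
      have "u (x + y) - q x \<le> u y" if "q \<in> C" for q
        by (rule greatest) (use *[OF that] in \<open>simp add: algebra_simps\<close>)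
      then have "u (x + y) - u y \<le> u x"
        by (intro greatest) (simp add: algebra_simps)
      then show "u (x + y) \<le> u x + u y" by simp
    next
      fix t :: real and x assume t: "0 < t"
      have "u (t *\<^sub>R x) / t \<le> u x"
      proof (rule greatest)
        fix q assume q: "q \<in> C"
        have "u (t *\<^sub>R x) \<le> t * q x"
          using below[OF q, of "t *\<^sub>R x"] CA[OF q] sublinear_scaleR[of q t x] t by (simp add: A_def)
        then show "u (t *\<^sub>R x) / t \<le> q x" using t by (simp add: field_simps)
      qed
      then show "u (t *\<^sub>R x) \<le> t * u x" using t by (simp add: field_simps)
    qed
    moreover have "u \<le> p"
    proof -
      obtain q where q: "q \<in> C" using False by blast
      show ?thesis
        using CA[OF q] below[OF q] by (auto simp: A_def le_fun_def intro: order_trans)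
    qed
    ultimately show ?thesis
      using below by (intro bexI[of _ u]) (auto simp: A_def le_fun_def)
  qed
  obtain f where f: "f \<in> A" "\<And>q. q \<in> A \<Longrightarrow> q \<le> f \<Longrightarrow> q = f"
    using predicate_Zorn[OF po chain] by auto
  have "linear f"
    using f by (intro minimal_sublinear_imp_linear) (auto simp: A_def)
  with f(1) that show ?thesis by (auto simp: A_def)
qed

text \<open>Starting the minimization from the norm linearized along \<open>y\<close> instead of the norm itself forces
  the value at \<open>- y\<close> down to \<open>- norm y\<close>.\<close>

lemma exists_real_norming_functional:
  fixes y :: "'a::real_normed_vector"
  obtains f :: "'a \<Rightarrow> real" where "linear f" "\<And>x. f x \<le> norm x" "f y = norm y"
proof -
  obtain f where f: "linear f" "f \<le> linearize_along y norm"
    using exists_linear_below_sublinear[OF sublinear_linearize_along[OF sublinear_norm]] by metis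
  have le: "f x \<le> norm x" for x
    using f(2) linearize_along_decreases[OF sublinear_norm, of y] by (auto simp: le_fun_def intro: order_trans)
  have "- f y \<le> - norm y"
    using le_funD[OF f(2), of "- y"] linearize_along_le[OF sublinear_norm, of 1 y "- y"]
    by (simp add: linear_neg[OF f(1)])
  then show ?thesis
    using that[OF f(1) le] le[of y] by simp
qed

lemma scaleC_zero_left [simp]: "0 *\<^sub>C x = (0::'a::complex_vector)"
  using scaleR_scaleC[of 0 x] by simp

text \<open>The complexification \<open>f x - \<i> f (\<i> x)\<close> of a real norming functional \<open>f\<close> is complex linear with real
  part \<open>f\<close>. Its modulus at \<open>x\<close> is the value of \<open>f\<close> at a rotation of \<open>x\<close>, hence at most \<open>norm x\<close>.
  At \<open>y\<close> the real part already exhausts the modulus, which leaves no room for an imaginary part.\<close>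

lemma exists_norming_functional:
  fixes y :: "'a::complex_banach"
  obtains u :: "'a \<Rightarrow> complex"
  where "complex_linear u" "\<And>x. cmod (u x) \<le> norm x" "u y = of_real (norm y)"
proof -
  obtain f :: "'a \<Rightarrow> real" where f: "linear f" "\<And>x. f x \<le> norm x" "f y = norm y"
    using exists_real_norming_functional by blast
  define u where "u x = Complex (f x) (- f (\<i> *\<^sub>C x))" for x
  have split: "c *\<^sub>C x = Re c *\<^sub>R x + Im c *\<^sub>R (\<i> *\<^sub>C x)" for c and x :: 'a
  proof -
    have "c *\<^sub>C x = (of_real (Re c) + of_real (Im c) * \<i>) *\<^sub>C x"
      by (metis complex_eq mult.commute)
    then show ?thesis by (simp only: scaleC_add_left scaleR_scaleC scaleC_scaleC)
  qed
  have u_scale: "u (c *\<^sub>C x) = c * u x" for c x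
  proof (rule complex_eqI)
    show "Re (u (c *\<^sub>C x)) = Re (c * u x)"
      by (simp add: u_def split[of c x] linear_add[OF f(1)] linear_cmul[OF f(1)])
    have "\<i> *\<^sub>C (c *\<^sub>C x) = (\<i> * c) *\<^sub>C x" by (simp add: scaleC_scaleC)
    then have "f (\<i> *\<^sub>C (c *\<^sub>C x)) = - Im c * f x + Re c * f (\<i> *\<^sub>C x)"
      by (simp add: split[of "\<i> * c" x] linear_add[OF f(1)] linear_diff[OF f(1)] linear_neg[OF f(1)]
          linear_cmul[OF f(1)])
    then show "Im (u (c *\<^sub>C x)) = Im (c * u x)"
      by (simp add: u_def)
  qed
  have lin: "complex_linear u"
    unfolding complex_linear_def
  proof (intro conjI allI)
    fix x z show "u (x + z) = u x + u z"
      by (simp add: u_def scaleC_add_right linear_add[OF f(1)] complex_eq_iff)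
  next
    fix c x show "u (c *\<^sub>C x) = c *\<^sub>C u x" by (simp add: u_scale scaleC_complex_def)
  qed
  have bound: "cmod (u x) \<le> norm x" for x
  proof (cases "u x = 0")
    case False
    define c where "c = cnj (u x) / of_real (cmod (u x))"
    have "cmod c = 1"
      using False by (simp add: c_def norm_divide)
    have "c * u x = of_real (cmod (u x))"
      using False complex_norm_square[of "u x"] by (simp add: c_def field_simps power2_eq_square)
    have "cmod (u x) = Re (u (c *\<^sub>C x))"
      by (simp add: u_scale \<open>c * u x = _\<close>)
    also have "\<dots> = f (c *\<^sub>C x)" by (simp add: u_def)
    also have "\<dots> \<le> norm (c *\<^sub>C x)" by (rule f(2))
    finally show ?thesis by (simp add: norm_scaleC \<open>cmod c = 1\<close>)
  qed simp
  have re: "Re (u y) = norm y" by (simp add: u_def f(3))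
  have "(Re (u y))\<^sup>2 + (Im (u y))\<^sup>2 \<le> (norm y)\<^sup>2"
    using power_mono[OF bound[of y], of 2] by (simp add: cmod_power2)
  then have "Im (u y) = 0" by (simp add: re)
  then have "u y = of_real (norm y)"
    using re by (simp add: complex_eq_iff)
  with that lin bound show ?thesis by blast
qed

section \<open>Holomorphic self-maps of the unit ball\<close>

text \<open>The Schwarz lemma applies to \<open>g\<close> followed by the Moebius map \<open>m\<close> of the disc that sends
  \<open>w = g 0\<close> to \<open>0\<close>, and the identity
  \<open>1 - \<bar>m \<zeta>\<bar>\<^sup>2 = (1 - \<bar>w\<bar>\<^sup>2) (1 - \<bar>\<zeta>\<bar>\<^sup>2) / \<bar>1 - cnj w * \<zeta>\<bar>\<^sup>2\<close> turns the bound for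
  \<open>m (g z)\<close> into one for \<open>g z\<close>. The estimate is weaker than the sharp Schwarz-Pick inequality,
  but what matters is that it depends on \<open>g\<close> only through an upper bound \<open>a\<close> of \<open>\<bar>g 0\<bar>\<close>, so that it is
  uniform over all functionals applied to a vector-valued map.\<close>

lemma Schwarz_Pick_growth:
  fixes g :: "complex \<Rightarrow> complex"
  assumes holo: "g holomorphic_on ball 0 1"
    and self: "\<And>z. cmod z < 1 \<Longrightarrow> cmod (g z) < 1"
    and a: "cmod (g 0) \<le> a" "a < 1" and z: "cmod z < 1"
  shows "(cmod (g z))\<^sup>2 \<le> 1 - (1 - (cmod z)\<^sup>2) * (1 - a)\<^sup>2"
proof -
  define w where "w = g 0"
  define m where "m \<zeta> = Moebius_function 0 w \<zeta>" for \<zeta>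
  have w: "cmod w < 1" using self[of 0] by (simp add: w_def)
  have "(Moebius_function 0 w \<circ> g) holomorphic_on ball 0 1"
    using self by (intro holomorphic_on_compose_gen[OF holo Moebius_function_holomorphic[OF w]]) auto
  moreover have "(Moebius_function 0 w \<circ> g) 0 = 0"
    by (simp add: w_def Moebius_function_eq_zero)
  ultimately have le: "cmod (m (g z)) \<le> cmod z"
    using Schwarz_Lemma(1)[of "Moebius_function 0 w \<circ> g" z] Moebius_function_norm_lt_1[OF w self] z
    by (simp add: m_def)
  have gz: "cmod (g z) < 1" using self[OF z] .
  define d where "d = 1 - cnj w * g z"
  have "1 - a \<le> 1 - cmod w * cmod (g z)"
    using mult_left_le[of "cmod (g z)" "cmod w"] gz a(1) by (simp add: w_def)
  also have "\<dots> \<le> cmod d"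
    using norm_triangle_ineq2[of 1 "cnj w * g z"] by (simp add: d_def norm_mult)
  finally have d: "1 - a \<le> cmod d" "0 < cmod d" using a(2) by auto
  have "cmod (m (g z)) * cmod d = cmod (g z - w)"
    using d(2) by (simp add: m_def Moebius_function_simple d_def norm_divide)
  moreover have "(cmod d)\<^sup>2 - (cmod (g z - w))\<^sup>2 = (1 - (cmod w)\<^sup>2) * (1 - (cmod (g z))\<^sup>2)"
    unfolding d_def cmod_power2 by (simp add: power2_eq_square algebra_simps)
  ultimately have "(1 - (cmod (m (g z)))\<^sup>2) * (cmod d)\<^sup>2 = (1 - (cmod w)\<^sup>2) * (1 - (cmod (g z))\<^sup>2)"
    by (simp add: left_diff_distrib flip: power_mult_distrib)
  also have "\<dots> \<le> 1 * (1 - (cmod (g z))\<^sup>2)"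
    using gz by (intro mult_right_mono) (auto simp: power_le_one)
  finally have "(1 - (cmod (m (g z)))\<^sup>2) * (cmod d)\<^sup>2 \<le> 1 - (cmod (g z))\<^sup>2" by simp
  moreover have "(1 - (cmod z)\<^sup>2) * (1 - a)\<^sup>2 \<le> (1 - (cmod (m (g z)))\<^sup>2) * (cmod d)\<^sup>2"
  proof (rule mult_mono)
    show "1 - (cmod z)\<^sup>2 \<le> 1 - (cmod (m (g z)))\<^sup>2"
      using power_mono[OF le, of 2] by simp
    show "(1 - a)\<^sup>2 \<le> (cmod d)\<^sup>2"
      using d(1) a(2) by (intro power_mono) auto
    show "0 \<le> 1 - (cmod (m (g z)))\<^sup>2"
      using le z by (simp add: power_le_one)
  qed simp
  ultimately show ?thesis by linarith
qed

lemma complex_linear_compose: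
  "complex_linear S \<Longrightarrow> complex_linear T \<Longrightarrow> complex_linear (\<lambda>x. S (T x))"
  by (simp add: complex_linear_def)

lemma frechet_holomorphic_compose:
  assumes f: "frechet_holomorphic_on f (ball 0 1)" and \<phi>: "frechet_holomorphic_on \<phi> S"
    and "\<phi> ` S \<subseteq> ball 0 1"
  shows "frechet_holomorphic_on (\<lambda>x. f (\<phi> x)) S"
  unfolding frechet_holomorphic_on_def
proof
  fix x assume x: "x \<in> S"
  obtain D where D: "(\<phi> has_derivative D) (at x)" "complex_linear D"
    using \<phi> x unfolding frechet_holomorphic_on_def by blast
  have "\<phi> x \<in> ball 0 1" using assms(3) x by blast
  then obtain E where E: "(f has_derivative E) (at (\<phi> x))" "complex_linear E"
    using f unfolding frechet_holomorphic_on_def by blast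
  show "\<exists>D. ((\<lambda>x. f (\<phi> x)) has_derivative D) (at x) \<and> complex_linear D"
    using has_derivative_compose[OF D(1) E(1)] complex_linear_compose[OF E(2) D(2)] by blast
qed

lemma bounded_complex_linear_imp_holomorphic:
  fixes u :: "'a::complex_banach \<Rightarrow> 'b::complex_banach"
  assumes u: "complex_linear u" and bound: "\<And>x. norm (u x) \<le> K * norm x"
  shows "frechet_holomorphic_on u S"
proof -
  have "bounded_linear u"
  proof (rule bounded_linear_intro)
    fix x y show "u (x + y) = u x + u y" using u by (simp add: complex_linear_def)
  next
    fix r x show "u (r *\<^sub>R x) = r *\<^sub>R u x" using u by (simp add: complex_linear_def scaleR_scaleC)
  next
    fix x show "norm (u x) \<le> norm x * K" using bound[of x] by (simp add: mult.commute)
  qed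
  then have "(u has_derivative u) (at x)" for x
    by (rule bounded_linear_imp_has_derivative)
  with u show ?thesis by (auto simp: frechet_holomorphic_on_def)
qed

lemma frechet_holomorphic_imp_holomorphic:
  fixes g :: "complex \<Rightarrow> complex"
  assumes "frechet_holomorphic_on g S" "open S"
  shows "g holomorphic_on S"
proof -
  have "g field_differentiable at z" if z: "z \<in> S" for z
  proof -
    obtain D where D: "(g has_derivative D) (at z)" "complex_linear D"
      using assms z by (auto simp: frechet_holomorphic_on_def)
    have "D h = D 1 * h" for h
    proof -
      have "D (h *\<^sub>C 1) = h *\<^sub>C D 1" using D(2) unfolding complex_linear_def by blast
      then show ?thesis by (simp add: scaleC_complex_def mult.commute)
    qed
    then have "D = (*) (D 1)" by (rule ext)
    then show ?thesis
      using D(1) unfolding field_differentiable_def has_field_derivative_def by metis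
  qed
  then show ?thesis
    using assms(2) by (simp add: holomorphic_on_open field_differentiable_def)
qed

text \<open>Why composition with \<open>\<phi>\<close> preserves functions of bounded type. A norming functional at \<open>\<phi> x\<close> and
  the complex line through \<open>x\<close> reduce the claim to a self-map of the disc. That map has modulus at
  most \<open>norm (\<phi> 0)\<close> at the origin, so the growth bound is the same for all \<open>x\<close> in \<open>ball 0 r\<close>.\<close>

lemma self_map_image_ball_bounded:
  fixes \<phi> :: "'a::complex_banach \<Rightarrow> 'a"
  assumes holo: "frechet_holomorphic_on \<phi> (ball 0 1)" and self: "\<phi> ` ball 0 1 \<subseteq> ball 0 1"
    and A: "ball_bounded A"
  shows "ball_bounded (\<phi> ` A)"
proof -
  obtain r where r: "0 < r" "r < 1" "A \<subseteq> ball 0 r"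
    using A by (auto simp: ball_bounded_def)
  define a where "a = norm (\<phi> 0)"
  have a: "0 \<le> a" "a < 1" using self by (auto simp: a_def image_subset_iff)
  define b where "b = sqrt (1 - (1 - r\<^sup>2) * (1 - a)\<^sup>2)"
  have bound: "norm (\<phi> x) \<le> b" if x: "norm x < r" for x
  proof -
    obtain u :: "'a \<Rightarrow> complex" where u: "complex_linear u" "\<And>x. cmod (u x) \<le> norm x"
        "u (\<phi> x) = of_real (norm (\<phi> x))"
      using exists_norming_functional[of "\<phi> x"] by blast
    \<comment> \<open>Scaled so that \<open>l r = x\<close>: every \<open>x\<close> is then evaluated at the same point \<open>r\<close> of the disc, and
    no separate treatment of \<open>x = 0\<close> arises.\<close>
    define l where "l z = z *\<^sub>C ((1/r) *\<^sub>R x)" for z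
    have l_norm: "norm (l z) \<le> cmod z" for z
      using x r mult_left_mono[of "norm x / r" 1 "cmod z"] by (simp add: l_def norm_scaleC)
    have l: "l ` ball 0 1 \<subseteq> ball 0 1"
      using order.strict_trans1[OF l_norm] by auto
    have "complex_linear l"
      by (simp add: complex_linear_def l_def scaleC_add_left scaleC_scaleC scaleC_complex_def)
    then have "frechet_holomorphic_on l (ball 0 1)"
      using l_norm by (intro bounded_complex_linear_imp_holomorphic[where K = 1]) auto
    then have "frechet_holomorphic_on (\<lambda>z. \<phi> (l z)) (ball 0 1)"
      using frechet_holomorphic_compose[OF holo _ l] by simp
    moreover have "frechet_holomorphic_on u (ball 0 1)"
      using u(1,2) by (intro bounded_complex_linear_imp_holomorphic[where K = 1]) auto
    moreover have "(\<lambda>z. \<phi> (l z)) ` ball 0 1 \<subseteq> ball 0 1"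
      using self l by blast
    ultimately have "frechet_holomorphic_on (\<lambda>z. u (\<phi> (l z))) (ball 0 1)"
      using frechet_holomorphic_compose[of u "\<lambda>z. \<phi> (l z)"] by blast
    then have "(\<lambda>z. u (\<phi> (l z))) holomorphic_on ball 0 1"
      by (rule frechet_holomorphic_imp_holomorphic) simp
    moreover have "cmod (u (\<phi> (l z))) < 1" if "cmod z < 1" for z
      using order.strict_trans1[OF u(2)[of "\<phi> (l z)"]] self l that by (auto simp: image_subset_iff)
    moreover have "cmod (u (\<phi> (l 0))) \<le> a"
      using u(2)[of "\<phi> 0"] by (simp add: l_def a_def)
    ultimately have "(cmod (u (\<phi> (l r))))\<^sup>2 \<le> 1 - (1 - (cmod r)\<^sup>2) * (1 - a)\<^sup>2"
      using a(2) r by (intro Schwarz_Pick_growth) auto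
    moreover have "l r = x"
      using r by (simp add: l_def scaleR_scaleC[symmetric])
    ultimately show ?thesis
      using r u(3) by (simp add: b_def real_le_rsqrt)
  qed
  have "b < 1"
  proof -
    have "r\<^sup>2 < 1" using r by (simp add: power_less_one_iff)
    then have "0 < (1 - r\<^sup>2) * (1 - a)\<^sup>2" using a(2) by simp
    then show ?thesis by (simp add: b_def)
  qed
  moreover have "0 \<le> b"
    using order_trans[OF norm_ge_zero bound[of 0]] r(1) by simp
  moreover have "norm (\<phi> x) < (b + 1) / 2" if "x \<in> A" for x
    using bound[of x] r(3) that \<open>b < 1\<close> by (auto simp: subset_eq)
  ultimately show ?thesis
    unfolding ball_bounded_def by (intro exI[of _ "(b + 1) / 2"]) auto
qed

section \<open>Seminorms on the space of functions of bounded type\<close>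

lemma Hb_fun_holomorphic: "frechet_holomorphic_on (Hb_fun f) (ball 0 1)"
  using Hb_fun[of f] by (simp add: Hb_set_def)

lemma Hb_fun_Abs_Hb:
  assumes g: "frechet_holomorphic_on g (ball 0 1)"
    and bounded: "\<And>A. ball_bounded A \<Longrightarrow> bounded (g ` A)" and x: "x \<in> ball 0 1"
  shows "Hb_fun (Abs_Hb (\<lambda>x. if x \<in> ball 0 1 then g x else 0)) x = g x"
proof -
  let ?h = "\<lambda>x. if x \<in> ball 0 1 then g x else 0"
  have "\<exists>D. (?h has_derivative D) (at y) \<and> complex_linear D" if y: "y \<in> ball 0 1" for y
  proof -
    obtain D where D: "(g has_derivative D) (at y)" "complex_linear D"
      using g y unfolding frechet_holomorphic_on_def by blast
    have "(?h has_derivative D) (at y)"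
      by (rule has_derivative_transform_within_open[OF D(1) open_ball y]) simp
    with D(2) show ?thesis by blast
  qed
  moreover have "bounded (?h ` A)" if A: "ball_bounded A" for A
    using bounded[OF A] by (rule bounded_subset[OF bounded_insert[THEN iffD2]]) auto
  ultimately have "?h \<in> Hb_set"
    by (auto simp: Hb_set_def frechet_holomorphic_on_def)
  then show ?thesis
    using x by (simp add: Abs_Hb_inverse)
qed

text \<open>Open balls of radius between \<open>0\<close> and \<open>1\<close> serve as the ball-bounded sets: every ball-bounded set lies
  in one of them, and as they contain \<open>0\<close>, the supremum is not over an empty set.\<close>

definition Hb_seminorm :: "real \<Rightarrow> 'a::complex_banach Hb \<Rightarrow> real"
  where "Hb_seminorm r f = (SUP x\<in>ball 0 r. cmod (Hb_fun f x))"

lemma cmod_le_Hb_seminorm: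
  assumes "0 < r" "r < 1" "norm x < r"
  shows "cmod (Hb_fun f x) \<le> Hb_seminorm r f"
proof -
  have "ball_bounded (ball 0 r)"
    using assms by (auto simp: ball_bounded_def)
  then obtain M where "\<And>x. x \<in> ball 0 r \<Longrightarrow> cmod (Hb_fun f x) \<le> M"
    using Hb_fun_bounded by metis
  then have "bdd_above ((\<lambda>x. cmod (Hb_fun f x)) ` ball 0 r)"
    by (intro bdd_aboveI2)
  then show ?thesis
    unfolding Hb_seminorm_def using assms by (intro cSUP_upper) auto
qed

lemma Hb_seminorm_le:
  assumes "0 < r" "\<And>x. norm x < r \<Longrightarrow> cmod (Hb_fun f x) \<le> M"
  shows "Hb_seminorm r f \<le> M"
  unfolding Hb_seminorm_def using assms by (intro cSUP_least) auto

lemma Hb_seminorm_nonneg: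
  assumes "0 < r" "r < 1"
  shows "0 \<le> Hb_seminorm r f"
  using cmod_le_Hb_seminorm[OF assms, of 0 f] assms order_trans[OF norm_ge_zero] by simp

lemma Hb_seminorm_triangle:
  assumes r: "0 < r" "r < 1"
  shows "Hb_seminorm r (f + g) \<le> Hb_seminorm r f + Hb_seminorm r g"
proof (rule Hb_seminorm_le[OF r(1)])
  fix x :: 'a assume "norm x < r"
  then show "cmod (Hb_fun (f + g) x) \<le> Hb_seminorm r f + Hb_seminorm r g"
    using cmod_le_Hb_seminorm[OF r, of x f] cmod_le_Hb_seminorm[OF r, of x g]
      norm_triangle_ineq[of "Hb_fun f x" "Hb_fun g x"] by simp
qed

lemma Hb_seminorm_scaleC_le:
  assumes r: "0 < r" "r < 1"
  shows "Hb_seminorm r (c *\<^sub>C f) \<le> cmod c * Hb_seminorm r f"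
  by (rule Hb_seminorm_le[OF r(1)])
    (simp add: norm_mult mult_left_mono cmod_le_Hb_seminorm[OF r])

lemma Hb_seminorm_scaleC:
  assumes r: "0 < r" "r < 1"
  shows "Hb_seminorm r (c *\<^sub>C f) = cmod c * Hb_seminorm r f"
proof (cases "c = 0")
  case True
  then show ?thesis
    using Hb_seminorm_scaleC_le[OF r, of 0 f] Hb_seminorm_nonneg[OF r, of "0 *\<^sub>C f"] by simp
next
  case False
  have "inverse c *\<^sub>C c *\<^sub>C f = f"
    using False by (simp add: scaleC_scaleC scaleC_one)
  then have "cmod c * Hb_seminorm r f \<le> Hb_seminorm r (c *\<^sub>C f)"
    using Hb_seminorm_scaleC_le[OF r, of "inverse c" "c *\<^sub>C f"] False
    by (simp add: norm_inverse norm_divide field_simps)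
  with Hb_seminorm_scaleC_le[OF r, of c f] show ?thesis by (rule antisym)
qed

lemma Hb_seminorm_diff_less:
  assumes r: "0 < r" "r < 1" and "0 < e" and "\<And>x. norm x < r \<Longrightarrow> cmod (Hb_fun g x - Hb_fun f x) < e / 2"
  shows "\<bar>Hb_seminorm r g - Hb_seminorm r f\<bar> < e"
proof -
  have "Hb_seminorm r g \<le> Hb_seminorm r f + e / 2" "Hb_seminorm r f \<le> Hb_seminorm r g + e / 2"
  proof (safe intro!: Hb_seminorm_le r(1))
    fix x :: 'a assume x: "norm x < r"
    show "cmod (Hb_fun g x) \<le> Hb_seminorm r f + e / 2" "cmod (Hb_fun f x) \<le> Hb_seminorm r g + e / 2"
      using assms(4)[OF x] cmod_le_Hb_seminorm[OF r x, of f] cmod_le_Hb_seminorm[OF r x, of g]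
        norm_triangle_ineq3[of "Hb_fun g x" "Hb_fun f x"] by linarith+
  qed
  with \<open>0 < e\<close> show ?thesis by linarith
qed

lemma Hb_seminorm_in_cont_seminorms:
  assumes r: "0 < r" "r < 1" and "0 \<le> C"
  shows "(\<lambda>f::'a::complex_banach Hb. C * Hb_seminorm r f) \<in> cont_seminorms"
proof -
  have ball: "ball_bounded (ball (0::'a) r)"
    using r by (auto simp: ball_bounded_def)
  have "(Hb_seminorm r \<longlongrightarrow> Hb_seminorm r f) (nhds f)" for f :: "'a Hb"
    unfolding tendsto_iff dist_real_def
  proof (intro allI impI)
    fix e :: real assume e: "0 < e"
    have "\<forall>\<^sub>F g in nhds f. \<forall>x\<in>ball 0 r. cmod (Hb_fun g x - Hb_fun f x) < e / 2"
      using e by (intro eventually_nhds_HbI ball) simp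
    then show "\<forall>\<^sub>F g in nhds f. \<bar>Hb_seminorm r g - Hb_seminorm r f\<bar> < e"
      by (rule eventually_mono) (intro Hb_seminorm_diff_less[OF r e], simp)
  qed
  then have "continuous_on UNIV (Hb_seminorm r :: 'a Hb \<Rightarrow> real)"
    unfolding continuous_on_def by (meson at_within_le_nhds filterlim_mono order_refl)
  then have "continuous_on UNIV (\<lambda>f::'a Hb. C * Hb_seminorm r f)"
    by (intro continuous_intros)
  moreover have "C * Hb_seminorm r (f + g) \<le> C * Hb_seminorm r f + C * Hb_seminorm r g" for f g :: "'a Hb"
    using mult_left_mono[OF Hb_seminorm_triangle[OF r, of f g] assms(3)] by (simp add: distrib_left)
  ultimately show ?thesis
    unfolding cont_seminorms_def
    by (simp add: Hb_seminorm_scaleC[OF r] mult.left_commute)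
qed

lemma open_zero_Hb_contains_ball:
  fixes U :: "'a::complex_banach Hb set"
  assumes "open U" "0 \<in> U"
  obtains r e where "0 < r" "r < 1" "0 < e" "\<And>f. Hb_seminorm r f < e \<Longrightarrow> f \<in> U"
proof -
  obtain A e where A: "ball_bounded A" "0 < e"
      "\<And>g. \<forall>x\<in>A. cmod (Hb_fun g x - Hb_fun 0 x) < e \<Longrightarrow> g \<in> U"
    using assms unfolding open_Hb_def by blast
  obtain r where r: "0 < r" "r < 1" "A \<subseteq> ball 0 r"
    using A(1) by (auto simp: ball_bounded_def)
  have "f \<in> U" if "Hb_seminorm r f < e" for f
  proof (rule A(3), intro ballI)
    fix x assume "x \<in> A"
    then have "norm x < r" using r(3) by auto
    then show "cmod (Hb_fun f x - Hb_fun 0 x) < e"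
      using cmod_le_Hb_seminorm[OF r(1,2), of x f] that by simp
  qed
  with that r A(2) show ?thesis by blast
qed

lemma open_Hb_seminorm_ball:
  assumes "0 < r" "r < 1"
  shows "open {f :: 'a::complex_banach Hb. Hb_seminorm r f < e}"
proof -
  have "continuous_on UNIV (\<lambda>f::'a Hb. 1 * Hb_seminorm r f)"
    using Hb_seminorm_in_cont_seminorms[OF assms zero_le_one] unfolding cont_seminorms_def by blast
  then show ?thesis
    using open_Collect_less[of "\<lambda>f::'a Hb. 1 * Hb_seminorm r f" "\<lambda>_. e"] by simp
qed

lemma cont_seminorm_scaleR:
  assumes "q \<in> cont_seminorms"
  shows "q (t *\<^sub>R x) = \<bar>t\<bar> * q x"
  using assms by (simp add: cont_seminorms_def scaleR_scaleC)

text \<open>The usual passage from a bound on a neighbourhood to a global estimate by scaling. The scaling factor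
  is \<open>e / M\<close> for every \<open>M\<close> above \<open>Hb_seminorm r f\<close>, as the seminorm itself may vanish at \<open>f\<close>.
  The lemma is applied both to seminorms and to seminorms precomposed with a linear operator, whence
  the bare homogeneity in place of membership in \<open>cont_seminorms\<close>.\<close>

lemma le_Hb_seminorm_if_small:
  fixes q :: "'a::complex_banach Hb \<Rightarrow> real"
  assumes r: "0 < r" "r < 1" and e: "0 < e"
    and homogeneous: "\<And>t f. 0 < t \<Longrightarrow> q (t *\<^sub>R f) = t * q f"
    and small: "\<And>f. Hb_seminorm r f < e \<Longrightarrow> q f \<le> 1"
  shows "q f \<le> (1 / e) * Hb_seminorm r f"
proof -
  have *: "q f \<le> M / e" if M: "Hb_seminorm r f < M" for M
  proof -
    have M0: "0 < M" using Hb_seminorm_nonneg[OF r, of f] M by simp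
    have "Hb_seminorm r ((e / M) *\<^sub>R f) = e * Hb_seminorm r f / M"
      using M0 e by (simp add: scaleR_scaleC Hb_seminorm_scaleC[OF r] norm_divide)
    also have "\<dots> < e" using M M0 e by (simp add: field_simps)
    finally have "(e / M) * q f \<le> 1"
      using small[of "(e / M) *\<^sub>R f"] homogeneous[of "e / M" f] M0 e by simp
    then show ?thesis using M0 e by (simp add: field_simps)
  qed
  have "q f * e \<le> Hb_seminorm r f"
    by (rule dense_ge) (use * e in \<open>simp add: field_simps\<close>)
  then show ?thesis using e by (simp add: field_simps)
qed

text \<open>Together with \<open>Hb_seminorm_in_cont_seminorms\<close> this says that the seminorms \<open>Hb_seminorm r\<close> define
  the topology; equicontinuity and topologizability can thus be tested on them.\<close>

lemma cont_seminorm_le_Hb_seminorm: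
  fixes p :: "'a::complex_banach Hb \<Rightarrow> real"
  assumes p: "p \<in> cont_seminorms"
  obtains r C where "0 < r" "r < 1" "0 < C" "\<And>f. p f \<le> C * Hb_seminorm r f"
proof -
  have "continuous_on UNIV p" using p by (simp add: cont_seminorms_def)
  then have "open {f. p f < 1}"
    using open_Collect_less[of p "\<lambda>_. 1"] by simp
  moreover have "p 0 = 0"
    using cont_seminorm_scaleR[OF p, of 0 0] by (simp add: scaleR_scaleC)
  ultimately obtain r e where re: "0 < r" "r < 1" "0 < e" "\<And>f. Hb_seminorm r f < e \<Longrightarrow> p f < 1"
    using open_zero_Hb_contains_ball[of "{f. p f < 1}"] by auto
  have "p f \<le> (1 / e) * Hb_seminorm r f" for f
    using re cont_seminorm_scaleR[OF p] by (intro le_Hb_seminorm_if_small) (auto intro: less_imp_le)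
  then show ?thesis using that[of r "1 / e"] re by simp
qed

lemma cont_seminorms_add:
  assumes "p \<in> cont_seminorms" "q \<in> cont_seminorms"
  shows "(\<lambda>x. p x + q x) \<in> cont_seminorms"
proof -
  have p: "p (x + y) \<le> p x + p y" "q (x + y) \<le> q x + q y" for x y
    using assms by (auto simp: cont_seminorms_def)
  show ?thesis
    using assms add_mono[OF p]
    by (auto simp: cont_seminorms_def algebra_simps intro: continuous_on_add)
qed

lemma equicontinuous_subset: "equicontinuous H \<Longrightarrow> G \<subseteq> H \<Longrightarrow> equicontinuous G"
  unfolding equicontinuous_def by (meson subset_iff)

text \<open>Powers of a contractive functional are the test functions that detect how far an orbit moves
  towards the unit sphere.\<close>

lemma power_of_contractive_functional_Hb:
  fixes u :: "'a::complex_banach \<Rightarrow> complex"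
  assumes u: "complex_linear u" "\<And>x. cmod (u x) \<le> norm x" and z: "z \<in> ball 0 1"
  shows "Hb_fun (Abs_Hb (\<lambda>x. if x \<in> ball 0 1 then u x ^ k else 0)) z = u z ^ k"
proof (rule Hb_fun_Abs_Hb[OF _ _ z])
  have u1: "cmod (u x) < 1" if "norm x < 1" for x
    using u(2)[of x] that by simp
  have "frechet_holomorphic_on u (ball 0 1)"
    using u by (intro bounded_complex_linear_imp_holomorphic[where K = 1]) auto
  moreover have "frechet_holomorphic_on (\<lambda>z::complex. z ^ k) (ball 0 1)"
    unfolding frechet_holomorphic_on_def
  proof
    fix w :: complex
    have "((\<lambda>z. z ^ k) has_field_derivative of_nat k * w ^ (k - 1)) (at w)"
      by (auto intro!: derivative_eq_intros)
    then show "\<exists>D. ((\<lambda>z. z ^ k) has_derivative D) (at w) \<and> complex_linear D"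
      unfolding has_field_derivative_def
      by (intro exI[of _ "(*) (of_nat k * w ^ (k - 1))"])
        (auto simp: complex_linear_def scaleC_complex_def algebra_simps)
  qed
  ultimately show "frechet_holomorphic_on (\<lambda>x. u x ^ k) (ball 0 1)"
    using u1 frechet_holomorphic_compose[of "\<lambda>z. z ^ k" u "ball 0 1"] by (auto simp: image_subset_iff)
next
  fix A :: "'a set" assume "ball_bounded A"
  then have "cmod (u x ^ k) \<le> 1" if "x \<in> A" for x
    using that u(2)[of x] by (auto simp: ball_bounded_def norm_power subset_eq intro!: power_le_one)
  then show "bounded ((\<lambda>x. u x ^ k) ` A)" by (auto simp: bounded_iff)
qed

section \<open>Iterates of composition operators\<close>

context
  fixes \<phi> :: "'a::complex_banach \<Rightarrow> 'a"
  assumes holo: "frechet_holomorphic_on \<phi> (ball 0 1)" and self: "\<phi> ` ball 0 1 \<subseteq> ball 0 1"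
begin

lemma comp_op_apply:
  assumes x: "x \<in> ball 0 1"
  shows "Hb_fun (comp_op \<phi> f) x = Hb_fun f (\<phi> x)"
  unfolding comp_op_def
proof (rule Hb_fun_Abs_Hb[OF _ _ x])
  show "frechet_holomorphic_on (\<lambda>x. Hb_fun f (\<phi> x)) (ball 0 1)"
    using frechet_holomorphic_compose[OF Hb_fun_holomorphic holo self] .
next
  fix A :: "'a set" assume "ball_bounded A"
  then have "bounded (Hb_fun f ` \<phi> ` A)"
    using self_map_image_ball_bounded[OF holo self] Hb_fun[of f] by (auto simp: Hb_set_def)
  then show "bounded ((\<lambda>x. Hb_fun f (\<phi> x)) ` A)" by (simp add: image_image)
qed

lemma iterate_in_ball: "x \<in> ball 0 1 \<Longrightarrow> (\<phi> ^^ n) x \<in> ball 0 1"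
  using self by (induction n) (auto simp: image_subset_iff)

lemma iterate_image_ball_bounded: "ball_bounded A \<Longrightarrow> ball_bounded ((\<phi> ^^ n) ` A)"
proof (induction n)
  case (Suc n)
  then have "ball_bounded (\<phi> ` (\<phi> ^^ n) ` A)"
    using self_map_image_ball_bounded[OF holo self] by blast
  then show ?case by (simp add: image_comp)
qed simp

lemma comp_op_iterate_apply:
  "x \<in> ball 0 1 \<Longrightarrow> Hb_fun ((comp_op \<phi> ^^ n) f) x = Hb_fun f ((\<phi> ^^ n) x)"
proof (induction n arbitrary: x)
  case (Suc n)
  have "\<phi> x \<in> ball 0 1" using self Suc.prems by blast
  then have "Hb_fun ((comp_op \<phi> ^^ Suc n) f) x = Hb_fun f ((\<phi> ^^ n) (\<phi> x))"
    using Suc by (simp add: comp_op_apply del: mem_ball)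
  then show ?case by (simp add: funpow_swap1)
qed simp

lemma weighted_iterate_linear:
  "complex_linear (\<lambda>f. c *\<^sub>R (comp_op \<phi> ^^ n) f)"
  unfolding complex_linear_def
  by (intro conjI allI Hb_eqI) (simp_all add: comp_op_iterate_apply algebra_simps)

lemma weighted_iterate_cont_linear:
  "(\<lambda>f. c *\<^sub>R (comp_op \<phi> ^^ n) f) \<in> cont_linear"
proof -
  have "((\<lambda>f. c *\<^sub>R (comp_op \<phi> ^^ n) f) \<longlongrightarrow> c *\<^sub>R (comp_op \<phi> ^^ n) f) (nhds f)" for f
  proof (rule tendsto_HbI)
    fix A :: "'a set" and e :: real assume A: "ball_bounded A" and e: "0 < e"
    define d where "d = e / (\<bar>c\<bar> + 1)"
    have d: "0 < d" "\<bar>c\<bar> * d < e" using e by (auto simp: d_def field_simps)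
    have "\<forall>\<^sub>F g in nhds f. \<forall>y\<in>(\<phi> ^^ n) ` A. cmod (Hb_fun g y - Hb_fun f y) < d"
      by (intro eventually_nhds_HbI iterate_image_ball_bounded A d(1))
    then show "\<forall>\<^sub>F g in nhds f. \<forall>x\<in>A.
        cmod (Hb_fun (c *\<^sub>R (comp_op \<phi> ^^ n) g) x - Hb_fun (c *\<^sub>R (comp_op \<phi> ^^ n) f) x) < e"
    proof (rule eventually_mono, intro ballI)
      fix g x
      assume *: "\<forall>y\<in>(\<phi> ^^ n) ` A. cmod (Hb_fun g y - Hb_fun f y) < d" and x: "x \<in> A"
      have "x \<in> ball 0 1" using A x by (auto simp: ball_bounded_def)
      then have "cmod (Hb_fun (c *\<^sub>R (comp_op \<phi> ^^ n) g) x - Hb_fun (c *\<^sub>R (comp_op \<phi> ^^ n) f) x)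
          = \<bar>c\<bar> * cmod (Hb_fun g ((\<phi> ^^ n) x) - Hb_fun f ((\<phi> ^^ n) x))"
        by (simp add: comp_op_iterate_apply norm_mult flip: right_diff_distrib)
      also have "\<dots> \<le> \<bar>c\<bar> * d"
        using * x by (intro mult_left_mono) (auto intro: less_imp_le)
      finally show "cmod (Hb_fun (c *\<^sub>R (comp_op \<phi> ^^ n) g) x
          - Hb_fun (c *\<^sub>R (comp_op \<phi> ^^ n) f) x) < e"
        using d(2) by simp
    qed
  qed
  then have "continuous_on UNIV (\<lambda>f. c *\<^sub>R (comp_op \<phi> ^^ n) f)"
    unfolding continuous_on_def by (meson at_within_le_nhds filterlim_mono order_refl)
  then show ?thesis
    using weighted_iterate_linear by (simp add: cont_linear_def)
qed

lemma comp_op_cont_linear: "comp_op \<phi> \<in> cont_linear"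
  using weighted_iterate_cont_linear[of 1 1] by simp

text \<open>If all iterates of \<open>\<phi>\<close> map \<open>ball 0 r\<close> into \<open>ball 0 s\<close>, the supremum of \<open>f \<circ> \<phi>\<^sup>n\<close> on the former is at
  most the supremum of \<open>f\<close> on the latter. The family \<open>H\<close> stands for the powers of the operator and
  for the powers divided by \<open>n\<close> alike.\<close>

lemma stable_orbits_imp_equicontinuous:
  assumes stable: "stable_orbits \<phi>"
    and H: "\<And>T. T \<in> H \<Longrightarrow> \<exists>c n. \<bar>c\<bar> \<le> 1 \<and> T = (\<lambda>f. c *\<^sub>R (comp_op \<phi> ^^ n) f)"
  shows "equicontinuous H"
  unfolding equicontinuous_def
proof (intro conjI allI impI)
  show "H \<subseteq> cont_linear" using H weighted_iterate_cont_linear by blast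
next
  fix U :: "'a Hb set" assume U: "open U \<and> 0 \<in> U"
  then obtain r e where r: "0 < r" "r < 1" and e: "0 < e" "\<And>f. Hb_seminorm r f < e \<Longrightarrow> f \<in> U"
    using open_zero_Hb_contains_ball by blast
  have "ball_bounded (ball (0::'a) r)" using r by (auto simp: ball_bounded_def)
  then obtain s where s: "0 < s" "s < 1" "\<And>n. (\<phi> ^^ n) ` ball 0 r \<subseteq> ball 0 s"
    using stable unfolding stable_orbits_def ball_bounded_def by (meson order_trans)
  have "T f \<in> U" if T: "T \<in> H" and f: "Hb_seminorm s f < e" for T f
  proof -
    obtain c n where c: "\<bar>c\<bar> \<le> 1" "T = (\<lambda>f. c *\<^sub>R (comp_op \<phi> ^^ n) f)"
      using H[OF T] by blast
    have "Hb_seminorm r (T f) \<le> Hb_seminorm s f"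
    proof (rule Hb_seminorm_le[OF r(1)])
      fix x :: 'a assume x: "norm x < r"
      have "norm ((\<phi> ^^ n) x) < s" using s(3)[of n] x by (simp add: image_subset_iff)
      then have "cmod (Hb_fun f ((\<phi> ^^ n) x)) \<le> Hb_seminorm s f"
        by (rule cmod_le_Hb_seminorm[OF s(1,2)])
      moreover have "cmod (Hb_fun (T f) x) \<le> cmod (Hb_fun f ((\<phi> ^^ n) x))"
        using x r c by (simp add: comp_op_iterate_apply norm_mult mult_left_le_one_le)
      ultimately show "cmod (Hb_fun (T f) x) \<le> Hb_seminorm s f" by simp
    qed
    with f e(2) show ?thesis by simp
  qed
  moreover have "Hb_seminorm s (0::'a Hb) < e"
    using e(1) Hb_seminorm_le[OF s(1), of "0::'a Hb" 0] by simp
  ultimately show "\<exists>V. open V \<and> 0 \<in> V \<and> (\<forall>T\<in>H. T ` V \<subseteq> U)"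
    using open_Hb_seminorm_ball[OF s(1,2)] by (intro exI[of _ "{f. Hb_seminorm s f < e}"]) auto
qed

text \<open>For each \<open>q\<close>, equicontinuity of the weighted powers provides one seminorm that controls \<open>q\<close> on all of
  them, and the weights are the sequence that topologizability asks for. The range \<open>1 \<le> n\<close> admits the weights \<open>1 / n\<close>.\<close>

lemma equicontinuous_imp_topologizable:
  assumes a: "\<And>n. 1 \<le> n \<Longrightarrow> 0 < a n"
    and equi: "equicontinuous {(\<lambda>f. a n *\<^sub>R (comp_op \<phi> ^^ n) f) | n. 1 \<le> n}"
  shows "topologizable (comp_op \<phi>)"
  unfolding topologizable_def
proof (intro conjI ballI comp_op_cont_linear)
  fix q :: "'a Hb \<Rightarrow> real" assume q: "q \<in> cont_seminorms"
  obtain r C where r: "0 < r" "r < 1" and C: "0 < C" "\<And>f. q f \<le> C * Hb_seminorm r f"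
    using cont_seminorm_le_Hb_seminorm[OF q] by blast
  have "open {f. q f < 1}"
    using q open_Collect_less[of q "\<lambda>_. 1"] by (simp add: cont_seminorms_def)
  moreover have "q 0 = 0"
    using cont_seminorm_scaleR[OF q, of 0 0] by (simp add: scaleR_scaleC)
  ultimately have "open {f. q f < 1} \<and> 0 \<in> {f. q f < 1}" by simp
  from equi[unfolded equicontinuous_def, THEN conjunct2, THEN spec, THEN mp, OF this]
  obtain V where V: "open V" "0 \<in> V"
    and V_image: "\<forall>T\<in>{(\<lambda>f. a n *\<^sub>R (comp_op \<phi> ^^ n) f) | n. 1 \<le> n}. T ` V \<subseteq> {f. q f < 1}"
    by (elim exE conjE)
  have small: "q (a n *\<^sub>R (comp_op \<phi> ^^ n) f) < 1" if "1 \<le> n" "f \<in> V" for n f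
  proof -
    have "(\<lambda>f. a n *\<^sub>R (comp_op \<phi> ^^ n) f) ` V \<subseteq> {f. q f < 1}"
      using that(1) by (intro bspec[OF V_image]) blast
    then show ?thesis using that(2) by (simp add: image_subset_iff)
  qed
  obtain s d where s: "0 < s" "s < 1" "0 < d" "\<And>f. Hb_seminorm s f < d \<Longrightarrow> f \<in> V"
    using open_zero_Hb_contains_ball[OF V(1,2)] by blast
  have iterate: "q (a n *\<^sub>R (comp_op \<phi> ^^ n) f) \<le> (1 / d) * Hb_seminorm s f" if n: "1 \<le> n" for n f
  proof (rule le_Hb_seminorm_if_small[OF s(1-3)])
    fix t :: real and f :: "'a Hb" assume t: "0 < t"
    have "a n *\<^sub>R (comp_op \<phi> ^^ n) (t *\<^sub>R f) = t *\<^sub>R (a n *\<^sub>R (comp_op \<phi> ^^ n) f)"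
      by (rule Hb_eqI) (simp add: comp_op_iterate_apply)
    then show "q (a n *\<^sub>R (comp_op \<phi> ^^ n) (t *\<^sub>R f)) = t * q (a n *\<^sub>R (comp_op \<phi> ^^ n) f)"
      using t by (simp only: cont_seminorm_scaleR[OF q, of t] abs_of_pos)
  next
    fix f :: "'a Hb" assume "Hb_seminorm s f < d"
    then show "q (a n *\<^sub>R (comp_op \<phi> ^^ n) f) \<le> 1"
      using small[OF n] s(4) by (simp add: less_imp_le)
  qed
  \<comment> \<open>The power \<open>n = 0\<close> lies outside the equicontinuous family. It gets the weight \<open>1\<close> and is controlled
  by a bound of \<open>q\<close> itself, which is the first summand.\<close>
  define p where "p f = C * Hb_seminorm r f + (1 / d) * Hb_seminorm s f" for f :: "'a Hb"
  define b where "b n = (if n = 0 then 1 else a n)" for n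
  have "p \<in> cont_seminorms"
    unfolding p_def
    using C(1) s(3) by (intro cont_seminorms_add Hb_seminorm_in_cont_seminorms r s) auto
  moreover have "0 < b n" for n using a[of n] by (simp add: b_def)
  moreover have "q (b n *\<^sub>R (comp_op \<phi> ^^ n) f) \<le> p f" for n f
  proof (cases "n = 0")
    case True
    then show ?thesis
      using C(2)[of f] s(3) Hb_seminorm_nonneg[OF s(1,2), of f] 
      by (simp add: b_def p_def add_increasing2)
  next
    case False
    then show ?thesis
      using iterate[of n f] C(1) Hb_seminorm_nonneg[OF r, of f]
      by (simp add: b_def p_def add_increasing)
  qed
  ultimately show "\<exists>a. \<exists>p\<in>cont_seminorms. (\<forall>n. 0 < a n) \<and>
      (\<forall>x n. q (a n *\<^sub>R (comp_op \<phi> ^^ n) x) \<le> p x)"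
    by blast
qed

text \<open>The heart of the equivalence. For a fixed \<open>n\<close>, the estimate
  \<open>a\<^sub>n sup \<bar>f \<circ> \<phi>\<^sup>n\<bar> \<le> C sup \<bar>f\<bar>\<close>, with the suprema over \<open>ball 0 r\<close> and \<open>ball 0 s\<close>, is applied to all powers
  \<open>u\<^sup>k\<close> of a norming functional at a point \<open>y\<close> of \<open>\<phi>\<^sup>n (ball 0 r)\<close>. It yields \<open>a\<^sub>n (norm y)\<^sup>k \<le> C s\<^sup>k\<close>,
  and \<open>k \<rightarrow> \<infinity>\<close> removes both constants and leaves \<open>norm y \<le> s\<close>. As \<open>s\<close> was chosen before \<open>n\<close>, the same
  radius works for all iterates, however fast the \<open>a\<^sub>n\<close> decay.\<close>

lemma topologizable_imp_stable_orbits: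
  assumes top: "topologizable (comp_op \<phi>)"
  shows "stable_orbits \<phi>"
  unfolding stable_orbits_def
proof (intro allI impI)
  fix A :: "'a set" assume "ball_bounded A"
  then obtain r where r: "0 < r" "r < 1" "A \<subseteq> ball 0 r"
    by (auto simp: ball_bounded_def)
  have "(\<lambda>f::'a Hb. 1 * Hb_seminorm r f) \<in> cont_seminorms"
    by (rule Hb_seminorm_in_cont_seminorms[OF r(1,2)]) simp
  then obtain a p where p: "p \<in> cont_seminorms" "\<And>n. 0 < a n"
      "\<And>f n. Hb_seminorm r (a n *\<^sub>R (comp_op \<phi> ^^ n) f) \<le> p f"
    using top unfolding topologizable_def by fastforce
  obtain s C where s: "0 < s" "s < 1" "0 < C" "\<And>f. p f \<le> C * Hb_seminorm s f"
    using cont_seminorm_le_Hb_seminorm[OF p(1)] by blast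
  have "norm ((\<phi> ^^ n) x) \<le> s" if x: "norm x < r" for n x
  proof (rule ccontr)
    define y where "y = (\<phi> ^^ n) x"
    assume "\<not> norm ((\<phi> ^^ n) x) \<le> s"
    then have y: "1 < norm y / s" using s(1) by (simp add: y_def)
    have x1: "x \<in> ball 0 1" using x r(2) by simp
    then have y1: "y \<in> ball 0 1" unfolding y_def by (rule iterate_in_ball)
    obtain u :: "'a \<Rightarrow> complex" where u: "complex_linear u" "\<And>x. cmod (u x) \<le> norm x"
        "u y = of_real (norm y)"
      using exists_norming_functional by blast
    have "(norm y / s) ^ k \<le> C / a n" for k
    proof -
      define F where "F = Abs_Hb (\<lambda>x. if x \<in> ball 0 1 then u x ^ k else 0)"
      have F: "Hb_fun F z = u z ^ k" if "z \<in> ball 0 1" for z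
        unfolding F_def using power_of_contractive_functional_Hb[OF u(1,2) that] .
      have "Hb_seminorm s F \<le> s ^ k"
      proof (rule Hb_seminorm_le[OF s(1)])
        fix z :: 'a assume z: "norm z < s"
        then have "cmod (u z) \<le> s" using u(2)[of z] by simp
        then show "cmod (Hb_fun F z) \<le> s ^ k"
          using z s(2) by (simp add: F norm_power power_mono)
      qed
      have "a n * norm y ^ k = cmod (Hb_fun (a n *\<^sub>R (comp_op \<phi> ^^ n) F) x)"
        using x1 y1 p(2)[of n]
        by (simp add: comp_op_iterate_apply F u(3) norm_mult norm_power flip: y_def)
      also have "\<dots> \<le> Hb_seminorm r (a n *\<^sub>R (comp_op \<phi> ^^ n) F)"
        by (rule cmod_le_Hb_seminorm[OF r(1,2) x])
      also have "\<dots> \<le> C * Hb_seminorm s F"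
        using p(3)[of n F] s(4)[of F] by simp
      also have "\<dots> \<le> C * s ^ k"
        using \<open>Hb_seminorm s F \<le> s ^ k\<close> s(3) by simp
      finally show ?thesis
        using s(1) p(2)[of n] by (simp add: power_divide field_simps)
    qed
    moreover obtain k where "C / a n < (norm y / s) ^ k"
      using real_arch_pow[OF y] by blast
    ultimately show False by (meson not_less)
  qed
  then have "(\<phi> ^^ n) ` A \<subseteq> cball 0 s" for n
    using r(3) by (auto simp: subset_eq)
  moreover have "ball_bounded (cball (0::'a) s)"
    unfolding ball_bounded_def using s(1,2) by (intro exI[of _ "(s + 1) / 2"]) auto
  ultimately show "\<exists>L. ball_bounded L \<and> (\<forall>n. (\<phi> ^^ n) ` A \<subseteq> L)"
    by blast
qed

end

section \<open>The equivalence\<close>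

theorem theorem5p2:
  fixes \<phi> :: "'a::complex_banach \<Rightarrow> 'a"
  assumes "frechet_holomorphic_on \<phi> (ball 0 1)"
    and "\<phi> ` ball 0 1 \<subseteq> ball 0 1"
  shows "(stable_orbits \<phi> \<longleftrightarrow> power_bounded (comp_op \<phi>)) \<and>
    (power_bounded (comp_op \<phi>) \<longleftrightarrow>
      equicontinuous {(\<lambda>f. (1 / real n) *\<^sub>R (comp_op \<phi> ^^ n) f) | n. 1 \<le> n}) \<and>
    (equicontinuous {(\<lambda>f. (1 / real n) *\<^sub>R (comp_op \<phi> ^^ n) f) | n. 1 \<le> n} \<longleftrightarrow>
      topologizable (comp_op \<phi>))"
proof -
  note holo_self = assms
  let ?means = "{(\<lambda>f. (1 / real n) *\<^sub>R (comp_op \<phi> ^^ n) f) | n. 1 \<le> n}"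
  have one: "(\<lambda>f. 1 *\<^sub>R (comp_op \<phi> ^^ n) f) = comp_op \<phi> ^^ n" for n
    by (rule ext) simp
  have "power_bounded (comp_op \<phi>)" if "stable_orbits \<phi>"
    unfolding power_bounded_def
  proof (intro conjI comp_op_cont_linear[OF holo_self] stable_orbits_imp_equicontinuous[OF holo_self that])
    fix T assume "T \<in> range (\<lambda>n. comp_op \<phi> ^^ n)"
    then obtain n where "T = comp_op \<phi> ^^ n" by blast
    then show "\<exists>c n. \<bar>c\<bar> \<le> 1 \<and> T = (\<lambda>f. c *\<^sub>R (comp_op \<phi> ^^ n) f)"
      using one[of n] by (intro exI[of _ 1] exI[of _ n]) simp
  qed
  moreover have "equicontinuous ?means" if "stable_orbits \<phi>"
  proof (rule stable_orbits_imp_equicontinuous[OF holo_self that])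
    fix T assume "T \<in> ?means"
    then obtain n where "1 \<le> n" "T = (\<lambda>f. (1 / real n) *\<^sub>R (comp_op \<phi> ^^ n) f)" by blast
    then show "\<exists>c n. \<bar>c\<bar> \<le> 1 \<and> T = (\<lambda>f. c *\<^sub>R (comp_op \<phi> ^^ n) f)"
      by (intro exI[of _ "1 / real n"] exI[of _ n]) simp
  qed
  moreover have "topologizable (comp_op \<phi>)" if "power_bounded (comp_op \<phi>)"
  proof (rule equicontinuous_imp_topologizable[OF holo_self, of "\<lambda>_. 1"])
    show "equicontinuous {(\<lambda>f. 1 *\<^sub>R (comp_op \<phi> ^^ n) f) | n. 1 \<le> n}"
      unfolding one using that unfolding power_bounded_def
      by (elim conjE equicontinuous_subset) blast
  qed simp
  moreover have "topologizable (comp_op \<phi>)" if "equicontinuous ?means"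
    using that by (rule equicontinuous_imp_topologizable[OF holo_self, rotated]) simp
  moreover have "stable_orbits \<phi>" if "topologizable (comp_op \<phi>)"
    using that by (rule topologizable_imp_stable_orbits[OF holo_self])
  ultimately show ?thesis by blast
qed

end
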